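(* Consider the minimization $$\min_{A,B}\ \mathbb{E}\left[\|Y-AB\sigma(Cx)\|_F^2\right]+\lambda_1\|A\|_F^2+\lambda_2\|B\|_F^2$$ over the training data from $m$ training manifolds $M_1,\dots,M_m$, subject to the constraint that the representation $r(x)=B\sigma(Cx)$ has zero intra-manifold variance on each training manifold. As $\lambda_1,\lambda_2\to0$ and for an infinitely wide random layer $C$, at the minimizer $\hat A,\hat B$ there is a linear transform $R$ such that $R\,\hat B\sigma(Cx_l)=\gamma_l$ for any $x_l$ from any of the $m$ training manifolds $M_l$.
   Context: Fix analytic functions $f=(f_1,\dots,f_d)$. For a latent vector $\gamma\in S^{s-1}\subset\mathbb{R}^s$, $M_\gamma=\{f(\gamma,\theta):\theta\in\Theta\}\subset S^{d-1}$, $\Theta\subseteq\mathbb{R}^k$. It is assumed that there is an analytic $g:\mathbb{R}^d\to\mathbb{R}^s$ with $g(f(\gamma,\theta))=\gamma$ for all points, with norm bounded by a constant, where the norm of a scalar analytic function $h$ is $\min\|a\|_2$ over $a$ with $a\,\sigma(C\cdot)\equiv h$ for an infinitely wide random ReLU layer. The training manifolds $M_1,\dots,M_m$ have latent vectors $\gamma_1,\dots,\gamma_m$; training points $x_l$ are drawn on $M_l$ and have one-hot label $e_l\in\mathbb{R}^m$; $Y$ collects the labels and the expectation is the average over the training data. The network is $\hat y=AB\sigma(Cx)$, with $\sigma$ the coordinatewise ReLU, $C\in\mathbb{R}^{D\times d}$ random with rows i.i.d. $\mathcal{N}(0,\frac1DI)$ and not trained ($D\to\infty$ here), and $A,B$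 trainable. A constant coordinate is appended to the rescaled input, $x\mapsto(x/\sqrt2,1/\sqrt2)$. Zero intra-manifold variance means that $r(x)$ takes a single value over the training points of each training manifold.
   Formalization: The dimension of the representation r(x) (the number of rows of B) is assumed to be at least m; with one row and two linearly independent latent vectors the claim is false. The points x_l range over the training points of M_l. *)

theory Defs
  imports "HOL-Probability.Probability"
begin

text \<open>
  Real-analyticity in several variables: near every point of \<open>S\<close> the function is the sum of a
  (necessarily absolutely) convergent multivariate power series. The multi-indices are the
  functions \<open>Basis \<rightarrow>\<^sub>E UNIV\<close> from coordinates to natural numbers.
\<close>

definition real_analytic_on ::
  "('a::euclidean_space \<Rightarrow> 'b::euclidean_space) \<Rightarrow> 'a set \<Rightarrow> bool" where
  "real_analytic_on h S \<longleftrightarrow>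
     (\<forall>a\<in>S. \<exists>c :: ('a \<Rightarrow> nat) \<Rightarrow> 'b. \<exists>e>0. \<forall>x\<in>ball a e.
        ((\<lambda>\<alpha>. (\<Prod>i\<in>Basis. ((x - a) \<bullet> i) ^ \<alpha> i) *\<^sub>R c \<alpha>) has_sum h x)
          (Basis \<rightarrow>\<^sub>E UNIV))"

definition manifold :: "('c \<Rightarrow> 'k \<Rightarrow> 'x) \<Rightarrow> 'k set \<Rightarrow> 'c \<Rightarrow> 'x set" where
  "manifold f \<Theta> \<gamma> = f \<gamma> ` \<Theta>"

definition relu :: "real \<Rightarrow> real" where
  "relu t = max 0 t"

definition with_bias :: "real^'d \<Rightarrow> (real^'d) \<times> real" where
  "with_bias x = (x /\<^sub>R sqrt 2, 1 / sqrt 2)"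

definition std_gaussian :: "'a::euclidean_space measure" where
  "std_gaussian = density lborel (\<lambda>w. ennreal (\<Prod>i\<in>Basis. std_normal_density (w \<bullet> i)))"

text \<open>
  The infinitely wide random layer. At width \<open>D\<close> the rows of \<open>C\<close> are \<open>w\<^sub>i / sqrt D\<close> with
  \<open>w\<^sub>i\<close> i.i.d. standard Gaussian. Writing the \<open>i\<close>-th column of \<open>B\<close> as \<open>b w\<^sub>i / sqrt D\<close> gives
  \<open>B \<sigma>(C x) = (1/D) (\<Sum>i<D. \<sigma>(w\<^sub>i \<bullet> x) b w\<^sub>i)\<close> and
  \<open>\<parallel>B\<parallel>\<^sub>F\<^sup>2 = (1/D) (\<Sum>i<D. \<parallel>b w\<^sub>i\<parallel>\<^sup>2)\<close>, whose limits as \<open>D \<rightarrow> \<infinity>\<close> are the Gaussian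
  expectations below. A matrix acting on the infinitely wide layer is therefore a
  square-integrable function \<open>b\<close> of the Gaussian weight vector, \<open>layer_map b x\<close> is its output
  on input \<open>x\<close>, and \<open>frobenius_sq b\<close> is its squared Frobenius norm.
\<close>

definition layer_weights :: "((real^'d) \<times> real \<Rightarrow> 'b::euclidean_space) set" where
  "layer_weights =
     {b \<in> borel_measurable borel. integrable std_gaussian (\<lambda>w. (norm (b w))\<^sup>2)}"

definition layer_map ::
  "((real^'d) \<times> real \<Rightarrow> 'b::euclidean_space) \<Rightarrow> real^'d \<Rightarrow> 'b" where
  "layer_map b x = (\<integral>w. relu (w \<bullet> with_bias x) *\<^sub>R b w \<partial>std_gaussian)"

definition frobenius_sq :: "((real^'d) \<times> real \<Rightarrow> 'b::euclidean_space) \<Rightarrow> real" where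
  "frobenius_sq b = (\<integral>w. (norm (b w))\<^sup>2 \<partial>std_gaussian)"

text \<open>
  The norm of a scalar function on the inputs, which are unit vectors. It is infinite if the
  function is not represented by any square-integrable weights.
\<close>

definition function_norm :: "(real^'d \<Rightarrow> real) \<Rightarrow> ennreal" where
  "function_norm h =
     (INF a\<in>{a \<in> layer_weights. \<forall>x\<in>sphere 0 1. layer_map a x = h x}.
        ennreal (sqrt (frobenius_sq a)))"

text \<open>
  The training data are a probability space \<open>P\<close> of training examples \<open>\<omega>\<close> with input \<open>X \<omega>\<close> and
  class \<open>L \<omega>\<close>. A finite data set is the uniform distribution on its index set; a manifold
  observed completely is covered as well.
\<close>

definition training_points ::
  "'w measure \<Rightarrow> ('w \<Rightarrow> 'x) \<Rightarrow> ('w \<Rightarrow> 'm) \<Rightarrow> 'm \<Rightarrow> 'x set" where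
  "training_points P X L l = X ` {\<omega> \<in> space P. L \<omega> = l}"

definition zero_intra_variance ::
  "'w measure \<Rightarrow> ('w \<Rightarrow> 'x) \<Rightarrow> ('w \<Rightarrow> 'm) \<Rightarrow> ('x \<Rightarrow> 'r) \<Rightarrow> bool" where
  "zero_intra_variance P X L r \<longleftrightarrow>
     (\<forall>l. \<forall>x\<in>training_points P X L l. \<forall>y\<in>training_points P X L l. r x = r y)"

text \<open>The norm of the type \<^typ>\<open>real^'p^'m\<close> is the Frobenius norm.\<close>

definition objective ::
  "'w measure \<Rightarrow> ('w \<Rightarrow> real^'d) \<Rightarrow> ('w \<Rightarrow> 'm) \<Rightarrow> real \<Rightarrow> real
     \<Rightarrow> (real^'p^'m) \<times> ((real^'d) \<times> real \<Rightarrow> real^'p) \<Rightarrow> real" where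
  "objective P X L lam1 lam2 = (\<lambda>(A, B).
     (\<integral>\<omega>. (norm (axis (L \<omega>) 1 - A *v layer_map B (X \<omega>)))\<^sup>2 \<partial>P)
       + lam1 * (norm A)\<^sup>2 + lam2 * frobenius_sq B)"

definition is_constrained_minimizer ::
  "'w measure \<Rightarrow> ('w \<Rightarrow> real^'d) \<Rightarrow> ('w \<Rightarrow> 'm) \<Rightarrow> real \<Rightarrow> real
     \<Rightarrow> real^'p^'m \<Rightarrow> ((real^'d) \<times> real \<Rightarrow> real^'p) \<Rightarrow> bool" where
  "is_constrained_minimizer P X L lam1 lam2 A B \<longleftrightarrow>
     is_arg_min (objective P X L lam1 lam2)
       (\<lambda>(A, B). B \<in> layer_weights \<and> zero_intra_variance P X L (layer_map B)) (A, B)"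

end

theory Submission
  imports Defs
begin

text \<open>
  The vectors of class values that scalar weights without intra-manifold variance can realise form
  a subspace \<open>T\<close> of \<open>real^'m\<close>; since \<open>g\<close> is representable, \<open>T\<close> contains every coordinate of the
  latent vectors. Coordinates are scaled by the square roots of the class probabilities, which turns
  the training loss into a squared Euclidean distance. Let \<open>S \<subseteq> T\<close> be the row space of the class representations at a minimizer.
  If \<open>S\<close> were a proper subspace, a unit vector of \<open>T\<close> orthogonal to \<open>S\<close> would force the training
  loss to exceed its infimum (attained by projecting the labels onto \<open>T\<close>) by at least the
  smallest class probability, whereas the regularisation of one fixed optimal solution tends to \<open>0\<close>.
  Hence \<open>S = T\<close> for small \<open>lam1\<close>, \<open>lam2\<close>, and the latent coordinates are linear in the representation.
\<close>

section \<open>Second moments of the Gaussian weight measure\<close>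

lemma sets_std_gaussian [simp, measurable_cong]:
  "sets (std_gaussian :: 'a::euclidean_space measure) = sets borel"
  by (simp add: std_gaussian_def)

lemma space_std_gaussian [simp]: "space (std_gaussian :: 'a::euclidean_space measure) = UNIV"
  by (simp add: std_gaussian_def)

lemma nn_integral_std_normal_density:
  "(\<integral>\<^sup>+ x. ennreal (std_normal_density x) \<partial>lborel) < \<infinity>"
  using integrable_std_normal_moment[of 0]
  by (simp add: integrable_iff_bounded)

lemma nn_integral_std_normal_density_moment2:
  "(\<integral>\<^sup>+ x. ennreal (std_normal_density x * x\<^sup>2) \<partial>lborel) < \<infinity>"
  using integrable_std_normal_moment[of 2]
  by (simp add: integrable_iff_bounded abs_mult)

text \<open>The density is a product over the coordinates and the square can be absorbed into the
  factor of coordinate \<open>i\<close>. By Tonelli the integral is then a product of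
  one-dimensional Gaussian moments of order 0 or 2, all finite.\<close>

lemma integrable_std_gaussian_coordinate_sq:
  fixes i :: "'a::euclidean_space"
  assumes i: "i \<in> Basis"
  shows "integrable std_gaussian (\<lambda>w. (w \<bullet> i)\<^sup>2)"
proof -
  define h :: "'a \<Rightarrow> real \<Rightarrow> ennreal" where
    "h j t = ennreal (std_normal_density t * (if j = i then t\<^sup>2 else 1))" for j t
  have h_meas: "h j \<in> borel_measurable borel" for j
    unfolding h_def by measurable
  have pt: "ennreal (\<Prod>j\<in>Basis. std_normal_density (w \<bullet> j)) * ennreal ((w \<bullet> i)\<^sup>2)
      = (\<Prod>j\<in>Basis. h j (w \<bullet> j))" for w :: 'a
  proof -
    have "(\<Prod>j\<in>Basis. std_normal_density (w \<bullet> j)) * (w \<bullet> i)\<^sup>2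
        = (\<Prod>j\<in>Basis. std_normal_density (w \<bullet> j) * (if j = i then (w \<bullet> j)\<^sup>2 else 1))"
      using i by (simp add: prod.distrib)
    then show ?thesis
      unfolding h_def by (simp add: prod_ennreal prod_nonneg flip: ennreal_mult)
  qed
  have fin: "(\<integral>\<^sup>+ t. h j t \<partial>lborel) < \<infinity>" for j
    using nn_integral_std_normal_density nn_integral_std_normal_density_moment2
    by (cases "j = i") (simp_all add: h_def)
  have "(\<integral>\<^sup>+ w. ennreal ((w \<bullet> i)\<^sup>2) \<partial>(std_gaussian :: 'a measure))
      = (\<integral>\<^sup>+ w. (\<Prod>j\<in>Basis. h j (w \<bullet> j)) \<partial>lborel)"
    unfolding std_gaussian_def by (subst nn_integral_density) (simp_all add: pt)
  also have "\<dots> = (\<Prod>j\<in>Basis. \<integral>\<^sup>+ t. h j t \<partial>lborel)"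
    by (rule nn_integral_lborel_prod) (use h_meas in \<open>simp_all\<close>)
  also have "\<dots> < \<infinity>"
    using fin by (simp add: less_top[symmetric] ennreal_prod_eq_top)
  finally show ?thesis
    by (simp add: integrable_iff_bounded)
qed

lemma integrable_std_gaussian_norm_sq:
  "integrable std_gaussian (\<lambda>w :: 'a::euclidean_space. (norm w)\<^sup>2)"
proof -
  have "(norm w)\<^sup>2 = (\<Sum>i\<in>Basis. (w \<bullet> i)\<^sup>2)" for w :: 'a
    by (subst power2_norm_eq_inner, subst euclidean_inner) (simp add: power2_eq_square)
  then show ?thesis
    by (simp add: integrable_std_gaussian_coordinate_sq)
qed

section \<open>Linear structure of the square-integrable layer weights\<close>

lemma relu_measurable [measurable]: "relu \<in> borel_measurable borel"
  unfolding relu_def by measurable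

lemma layer_weights_measurable:
  "b \<in> layer_weights \<Longrightarrow> b \<in> borel_measurable borel"
  by (simp add: layer_weights_def)

text \<open>By Cauchy-Schwarz the ReLU feature is at most
  \<open>norm (with_bias x) * norm w\<close>, so the integrand is dominated by a product of two
  square-integrable functions. For \<open>p * q\<close> nonnegative, \<open>p * q\<close> is at most
  the sum of the two squares, which gives an integrable bound.\<close>

lemma integrable_layer_map:
  fixes b :: "(real^'d) \<times> real \<Rightarrow> 'b::euclidean_space"
  assumes "b \<in> layer_weights"
  shows "integrable std_gaussian (\<lambda>w. relu (w \<bullet> with_bias x) *\<^sub>R b w)"
proof (rule Bochner_Integration.integrable_bound)
  let ?y = "with_bias x"
  show "integrable std_gaussian (\<lambda>w. (norm ?y)\<^sup>2 * (norm w)\<^sup>2 + (norm (b w))\<^sup>2)"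
    using assms by (auto simp: layer_weights_def integrable_std_gaussian_norm_sq)
  have [measurable]: "b \<in> borel_measurable borel"
    using assms by (rule layer_weights_measurable)
  show "(\<lambda>w. relu (w \<bullet> ?y) *\<^sub>R b w) \<in> borel_measurable std_gaussian"
    by measurable
  show "AE w in std_gaussian. norm (relu (w \<bullet> ?y) *\<^sub>R b w)
      \<le> norm ((norm ?y)\<^sup>2 * (norm w)\<^sup>2 + (norm (b w))\<^sup>2)"
  proof (rule AE_I2)
    fix w
    have "\<bar>relu (w \<bullet> ?y)\<bar> \<le> norm ?y * norm w"
      using Cauchy_Schwarz_ineq2[of w ?y] by (auto simp: relu_def mult.commute)
    then have "norm (relu (w \<bullet> ?y) *\<^sub>R b w) \<le> (norm ?y * norm w) * norm (b w)"
      by (simp add: mult_right_mono)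
    also have "\<dots> \<le> (norm ?y * norm w)\<^sup>2 + (norm (b w))\<^sup>2"
    proof -
      have "p * q \<le> p\<^sup>2 + q\<^sup>2" if "0 \<le> p * q" for p q :: real
        using that sum_squares_bound[of p q] by linarith
      then show ?thesis
        by simp
    qed
    finally show "norm (relu (w \<bullet> ?y) *\<^sub>R b w)
        \<le> norm ((norm ?y)\<^sup>2 * (norm w)\<^sup>2 + (norm (b w))\<^sup>2)"
      by (simp add: power_mult_distrib)
  qed
qed

text \<open>One closure property covers three later uses: scaling by a constant, taking the inner
  product with a fixed vector \<open>u\<close>, and placing a scalar weight on one hidden
  coordinate.\<close>

lemma layer_weights_bounded_linear:
  fixes b :: "(real^'d) \<times> real \<Rightarrow> 'b::euclidean_space" and h :: "'b \<Rightarrow> 'c::euclidean_space"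
  assumes b: "b \<in> layer_weights" and h: "bounded_linear h"
  shows "(\<lambda>w. h (b w)) \<in> layer_weights"
proof -
  have [measurable]: "b \<in> borel_measurable borel"
    using b by (rule layer_weights_measurable)
  have [measurable]: "h \<in> borel_measurable borel"
    using h by (simp add: borel_measurable_continuous_onI linear_continuous_on)
  obtain c where c: "\<And>x. norm (h x) \<le> norm x * c"
    using bounded_linear.bounded[OF h] by blast
  have "integrable std_gaussian (\<lambda>w. (norm (h (b w)))\<^sup>2)"
  proof (rule Bochner_Integration.integrable_bound)
    show "integrable std_gaussian (\<lambda>w. c\<^sup>2 * (norm (b w))\<^sup>2)"
      using b by (simp add: layer_weights_def)
    show "AE w in std_gaussian. norm ((norm (h (b w)))\<^sup>2) \<le> norm (c\<^sup>2 * (norm (b w))\<^sup>2)"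
      using power_mono[OF c, of _ 2] by (intro AE_I2) (simp add: power_mult_distrib mult.commute)
  qed measurable
  then show ?thesis
    by (simp add: layer_weights_def)
qed

lemma layer_map_bounded_linear:
  assumes "b \<in> layer_weights" and h: "bounded_linear h"
  shows "layer_map (\<lambda>w. h (b w)) x = h (layer_map b x)"
  using integral_bounded_linear[OF h integrable_layer_map[OF assms(1), of x]]
  \<comment> \<open>The cited simplification rule is homogeneity: it pulls the scalar ReLU factor
    out of \<open>h\<close>.\<close>
  by (simp add: layer_map_def linear_simps(5)[OF h])

lemma layer_weights_add:
  fixes a b :: "(real^'d) \<times> real \<Rightarrow> 'b::euclidean_space"
  assumes a: "a \<in> layer_weights" and b: "b \<in> layer_weights"
  shows "(\<lambda>w. a w + b w) \<in> layer_weights"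
proof -
  have [measurable]: "a \<in> borel_measurable borel" "b \<in> borel_measurable borel"
    using a b by (auto intro: layer_weights_measurable)
  have "integrable std_gaussian (\<lambda>w. (norm (a w + b w))\<^sup>2)"
  proof (rule Bochner_Integration.integrable_bound)
    show "integrable std_gaussian (\<lambda>w. 2 * (norm (a w))\<^sup>2 + 2 * (norm (b w))\<^sup>2)"
      using a b by (simp add: layer_weights_def)
    show "AE w in std_gaussian. norm ((norm (a w + b w))\<^sup>2)
        \<le> norm (2 * (norm (a w))\<^sup>2 + 2 * (norm (b w))\<^sup>2)"
    proof (rule AE_I2)
      fix w
      have "(norm (a w + b w))\<^sup>2 \<le> (norm (a w) + norm (b w))\<^sup>2"
        by (simp add: norm_triangle_ineq power_mono)
      also have "\<dots> \<le> 2 * (norm (a w))\<^sup>2 + 2 * (norm (b w))\<^sup>2"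
        using sum_squares_bound[of "norm (a w)" "norm (b w)"] by (simp add: power2_sum)
      finally show "norm ((norm (a w + b w))\<^sup>2)
          \<le> norm (2 * (norm (a w))\<^sup>2 + 2 * (norm (b w))\<^sup>2)"
        by simp
    qed
  qed measurable
  then show ?thesis
    by (simp add: layer_weights_def)
qed

lemma layer_map_add:
  assumes "a \<in> layer_weights" "b \<in> layer_weights"
  shows "layer_map (\<lambda>w. a w + b w) x = layer_map a x + layer_map b x"
  using assms by (simp add: layer_map_def scaleR_add_right integrable_layer_map)

lemma layer_weights_zero: "(\<lambda>w. 0) \<in> layer_weights"
  by (simp add: layer_weights_def)

lemma layer_map_zero: "layer_map (\<lambda>w. 0) x = 0"
  by (simp add: layer_map_def)

lemma layer_weights_sum:
  "finite I \<Longrightarrow> (\<And>i. i \<in> I \<Longrightarrow> b i \<in> layer_weights) \<Longrightarrow> (\<lambda>w. \<Sum>i\<in>I. b i w) \<in> layer_weights"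
  by (induction I rule: finite_induct) (simp_all add: layer_weights_zero layer_weights_add)

lemma layer_map_sum:
  "finite I \<Longrightarrow> (\<And>i. i \<in> I \<Longrightarrow> b i \<in> layer_weights) \<Longrightarrow>
     layer_map (\<lambda>w. \<Sum>i\<in>I. b i w) x = (\<Sum>i\<in>I. layer_map (b i) x)"
  by (induction I rule: finite_induct)
    (simp_all add: layer_map_zero layer_weights_sum layer_map_add)

lemma frobenius_sq_nonneg: "frobenius_sq b \<ge> 0"
  by (simp add: frobenius_sq_def)

section \<open>Realizable class values and the subspace gap\<close>

lemma function_norm_finite_imp_layer_map:
  assumes "function_norm h \<le> ennreal K"
  obtains a where "a \<in> layer_weights" "\<And>x. x \<in> sphere 0 1 \<Longrightarrow> layer_map a x = h x"
proof (cases "{a \<in> layer_weights. \<forall>x\<in>sphere 0 1. layer_map a x = h x} = {}")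
  case True
  \<comment> \<open>The infimum over the empty set is \<open>top\<close>, which contradicts the
    finite bound; so some representing weights exist.\<close>
  then have "function_norm h = top"
    unfolding function_norm_def True by simp
  with assms show ?thesis
    by (simp add: top_unique)
next
  case False
  then show ?thesis
    using that by blast
qed

text \<open>A scalar output that is constant on each class is recorded by its vector of class
  values. This replaces the infinite-dimensional space of weights by a subspace of the
  finite-dimensional \<open>real^'m\<close>.\<close>

definition realizable_values ::
  "'w measure \<Rightarrow> ('w \<Rightarrow> real^'d) \<Rightarrow> ('w \<Rightarrow> 'm::finite) \<Rightarrow> (real^'m) set" where
  "realizable_values P X L =
     {c. \<exists>b\<in>layer_weights. \<forall>\<omega>\<in>space P. layer_map b (X \<omega>) = c $ L \<omega>}"

lemma subspace_realizable_values: "subspace (realizable_values P X L)"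
proof (rule subspaceI)
  show "0 \<in> realizable_values P X L"
    unfolding realizable_values_def
    by (auto intro!: bexI[OF _ layer_weights_zero] simp: layer_map_zero)
next
  fix x y assume "x \<in> realizable_values P X L" "y \<in> realizable_values P X L"
  then obtain a b where "a \<in> layer_weights" "\<And>\<omega>. \<omega> \<in> space P \<Longrightarrow> layer_map a (X \<omega>) = x $ L \<omega>"
      "b \<in> layer_weights" "\<And>\<omega>. \<omega> \<in> space P \<Longrightarrow> layer_map b (X \<omega>) = y $ L \<omega>"
    by (auto simp: realizable_values_def)
  then show "x + y \<in> realizable_values P X L"
    unfolding realizable_values_def
    by (auto intro!: bexI[of _ "\<lambda>w. a w + b w"] simp: layer_weights_add layer_map_add)
next
  fix c x assume "x \<in> realizable_values P X L"
  then obtain a where "a \<in> layer_weights" "\<And>\<omega>. \<omega> \<in> space P \<Longrightarrow> layer_map a (X \<omega>) = x $ L \<omega>"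
    by (auto simp: realizable_values_def)
  then show "c *\<^sub>R x \<in> realizable_values P X L"
    unfolding realizable_values_def
    using layer_weights_bounded_linear[OF _ bounded_linear_scaleR_right[of c], of a]
      layer_map_bounded_linear[OF _ bounded_linear_scaleR_right[of c], of a]
    by (auto intro!: bexI[of _ "\<lambda>w. c *\<^sub>R a w"])
qed

text \<open>\<open>Q j\<close> is the orthogonal projection of the scaled label row onto
  \<open>T\<close>. Take a unit vector \<open>v\<close> of \<open>T\<close> orthogonal to
  \<open>S\<close>. As \<open>M j\<close> lies in \<open>S\<close>, the difference
  \<open>Q j - M j\<close> has inner product \<open>s j * v $ j\<close> with \<open>v\<close>, so by
  Pythagoras row \<open>j\<close> costs at least \<delta> times the square of \<open>v $ j\<close>
  more than the projection. Summing over \<open>j\<close> gives an excess of at least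
  \<delta>.\<close>

lemma subspace_eq_if_near_optimal:
  fixes S T :: "(real^'m) set" and s :: "'m \<Rightarrow> real" and M Q :: "'m \<Rightarrow> real^'m"
  assumes S: "subspace S" and T: "subspace T" and ST: "S \<subseteq> T"
    and M: "\<And>j. M j \<in> S"
    and Q: "\<And>j. Q j \<in> T" "\<And>j t. t \<in> T \<Longrightarrow> (axis j (s j) - Q j) \<bullet> t = 0"
    and \<delta>: "\<And>j. \<delta> \<le> (s j)\<^sup>2"
    and less: "(\<Sum>j\<in>UNIV. (norm (axis j (s j) - M j))\<^sup>2)
      < (\<Sum>j\<in>UNIV. (norm (axis j (s j) - Q j))\<^sup>2) + \<delta>"
  shows "S = T"
proof (rule ccontr)
  assume "S \<noteq> T"
  then have "span S \<subset> span T"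
    using S T ST by (simp add: span_eq_iff[THEN iffD2] psubset_eq)
  then obtain x where x: "x \<noteq> 0" "x \<in> span T" "\<And>y. y \<in> span S \<Longrightarrow> orthogonal x y"
    using orthogonal_to_subspace_exists_gen by metis
  define v where "v = x /\<^sub>R norm x"
  have v: "norm v = 1" "v \<in> T" "\<And>y. y \<in> S \<Longrightarrow> v \<bullet> y = 0"
    using x S T by (auto simp: v_def subspace_scale span_eq_iff[THEN iffD2] orthogonal_def)
  have row: "(norm (axis j (s j) - M j))\<^sup>2 \<ge> (norm (axis j (s j) - Q j))\<^sup>2 + \<delta> * (v $ j)\<^sup>2" for j
  proof -
    let ?a = "axis j (s j) - Q j" and ?d = "Q j - M j"
    have "?d \<in> T"
      using M Q(1) ST T by (auto intro: subspace_diff)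
    then have "?a \<bullet> ?d = 0"
      using Q(2) by blast
    then have pyth: "(norm (?a + ?d))\<^sup>2 = (norm ?a)\<^sup>2 + (norm ?d)\<^sup>2"
      unfolding orthogonal_def[symmetric] by (rule norm_add_Pythagorean)
    \<comment> \<open>\<open>v\<close> is orthogonal to \<open>M j\<close> because
      \<open>M j\<close> is in \<open>S\<close>, and to the residual
      \<open>axis j (s j) - Q j\<close> because \<open>v\<close> is in \<open>T\<close>.\<close>
    have "v \<bullet> ?d = v \<bullet> axis j (s j)"
      using Q(2)[OF v(2), of j] v(3)[OF M[of j]]
      by (simp add: inner_diff_left inner_diff_right inner_commute)
    then have "s j * v $ j = v \<bullet> ?d"
      by (simp add: inner_axis mult.commute)
    then have "(s j * v $ j)\<^sup>2 \<le> (norm ?d)\<^sup>2"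
      using Cauchy_Schwarz_ineq2[of v ?d] v(1) by (simp add: abs_le_square_iff[symmetric])
    moreover have "\<delta> * (v $ j)\<^sup>2 \<le> (s j * v $ j)\<^sup>2"
      using \<delta>[of j] by (simp add: power_mult_distrib mult_right_mono)
    ultimately show ?thesis
      using pyth by simp
  qed
  have "(\<Sum>j\<in>UNIV. (v $ j)\<^sup>2) = 1"
    using v(1) by (simp add: norm_vec_def L2_set_def)
  then have "(\<Sum>j\<in>UNIV. (norm (axis j (s j) - Q j))\<^sup>2) + \<delta>
      = (\<Sum>j\<in>UNIV. (norm (axis j (s j) - Q j))\<^sup>2 + \<delta> * (v $ j)\<^sup>2)"
    by (simp add: sum.distrib flip: sum_distrib_left)
  also have "\<dots> \<le> (\<Sum>j\<in>UNIV. (norm (axis j (s j) - M j))\<^sup>2)"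
    by (intro sum_mono row)
  finally show False
    using less by simp
qed

section \<open>The training loss in class coordinates\<close>

lemma expectation_finite_class:
  fixes L :: "'w \<Rightarrow> 'm::finite" and h :: "'m \<Rightarrow> real"
  assumes "prob_space P" and L: "L \<in> measurable P (count_space UNIV)"
  shows "(\<integral>\<omega>. h (L \<omega>) \<partial>P) = (\<Sum>l\<in>UNIV. measure P {\<omega> \<in> space P. L \<omega> = l} * h l)"
proof -
  interpret prob_space P by fact
  have sets: "{\<omega> \<in> space P. L \<omega> = l} \<in> sets P" for l
    using measurable_sets[OF L, of "{l}"] by (simp add: vimage_def Int_def conj_commute)
  have "h (L \<omega>) = (\<Sum>l\<in>UNIV. indicator {\<omega> \<in> space P. L \<omega> = l} \<omega> * h l)" if "\<omega> \<in> space P" for \<omega>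
    using that by (simp add: indicator_def if_distrib[of "\<lambda>x. x * _"] cong: if_cong)
  then have "(\<integral>\<omega>. h (L \<omega>) \<partial>P)
      = (\<integral>\<omega>. (\<Sum>l\<in>UNIV. indicator {\<omega> \<in> space P. L \<omega> = l} \<omega> * h l) \<partial>P)"
    by (intro Bochner_Integration.integral_cong) auto
  also have "\<dots> = (\<Sum>l\<in>UNIV. measure P {\<omega> \<in> space P. L \<omega> = l} * h l)"
    using sets by (subst Bochner_Integration.integral_sum) (auto simp: emeasure_eq_measure)
  finally show ?thesis .
qed

text \<open>The expectation is a sum over classes \<open>l\<close> weighted by the squares of
  \<open>s l\<close>; moving \<open>s l\<close> inside the norm and exchanging the sums groups the
  loss by output coordinate \<open>j\<close>. Each output coordinate is one linear functional of the
  representation, so its class values form a vector in the row space.\<close>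

lemma objective_class_values:
  fixes L :: "'w \<Rightarrow> 'm::finite" and A :: "real^'p^'m"
  assumes P: "prob_space P" "L \<in> measurable P (count_space UNIV)"
    and r: "\<And>\<omega>. \<omega> \<in> space P \<Longrightarrow> layer_map B (X \<omega>) = r (L \<omega>)"
    and s: "\<And>l. s l = sqrt (measure P {\<omega> \<in> space P. L \<omega> = l})"
  shows "objective P X L lam1 lam2 (A, B) =
    (\<Sum>j\<in>UNIV. (norm (axis j (s j) - (\<chi> l. s l * (A $ j \<bullet> r l))))\<^sup>2)
      + lam1 * (norm A)\<^sup>2 + lam2 * frobenius_sq B"
proof -
  have norm_sq: "(norm z)\<^sup>2 = (\<Sum>i\<in>UNIV. (z $ i)\<^sup>2)" for z :: "real^'m"
    by (simp add: norm_vec_def L2_set_def sum_nonneg)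
  have "(\<integral>\<omega>. (norm (axis (L \<omega>) 1 - A *v layer_map B (X \<omega>)))\<^sup>2 \<partial>P)
      = (\<integral>\<omega>. (norm (axis (L \<omega>) 1 - A *v r (L \<omega>)))\<^sup>2 \<partial>P)"
    by (intro Bochner_Integration.integral_cong) (simp_all add: r)
  also have "\<dots> = (\<Sum>l\<in>UNIV. (s l)\<^sup>2 * (norm (axis l 1 - A *v r l))\<^sup>2)"
    by (subst expectation_finite_class[OF P, where h = "\<lambda>l. (norm (axis l 1 - A *v r l))\<^sup>2"])
      (simp add: s)
  also have "\<dots> = (\<Sum>l\<in>UNIV. \<Sum>j\<in>UNIV. (axis j (s j) $ l - s l * (A $ j \<bullet> r l))\<^sup>2)"
  proof (intro sum.cong refl)
    fix l
    \<comment> \<open>The label entries match: \<open>s l * axis l 1 $ j\<close> and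
      \<open>axis j (s j) $ l\<close> both equal \<open>s j\<close> if \<open>j = l\<close> and 0
      otherwise.\<close>
    have "(s l)\<^sup>2 * ((axis l 1 - A *v r l) $ j)\<^sup>2 = (axis j (s j) $ l - s l * (A $ j \<bullet> r l))\<^sup>2" for j
      by (auto simp: axis_def matrix_vector_mul_component right_diff_distrib
          simp flip: power_mult_distrib)
    then show "(s l)\<^sup>2 * (norm (axis l 1 - A *v r l))\<^sup>2
        = (\<Sum>j\<in>UNIV. (axis j (s j) $ l - s l * (A $ j \<bullet> r l))\<^sup>2)"
      by (simp add: norm_sq sum_distrib_left)
  qed
  also have "\<dots> = (\<Sum>j\<in>UNIV. (norm (axis j (s j) - (\<chi> l. s l * (A $ j \<bullet> r l))))\<^sup>2)"
    by (subst sum.swap) (simp add: norm_sq)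
  finally show ?thesis
    by (simp add: objective_def)
qed

section \<open>Vanishing regularization and recovery of the latent vectors\<close>

lemma eventually_regularization_less:
  fixes a b \<delta> :: real
  assumes "a \<ge> 0" "b \<ge> 0" "\<delta> > 0"
  shows "\<forall>\<^sub>F (lam1, lam2) in at_right 0 \<times>\<^sub>F at_right 0.
    0 < lam1 \<and> 0 < lam2 \<and> lam1 * a + lam2 * b < \<delta>"
proof -
  \<comment> \<open>Each penalty gets half of \<delta>, so the two parameters may tend to 0
    independently, as the product filter demands.\<close>
  have half: "\<forall>\<^sub>F x in at_right 0. 0 < x \<and> x * c < \<delta> / 2" for c :: real
  proof (rule eventually_conj)
    show "\<forall>\<^sub>F x in at_right 0. 0 < (x :: real)"
      by (simp add: eventually_at_right_less)
    have "((\<lambda>x. x * c) \<longlongrightarrow> 0 * c) (at_right 0)"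
      by (intro tendsto_intros)
    then show "\<forall>\<^sub>F x in at_right 0. x * c < \<delta> / 2"
      using assms(3) by (intro order_tendstoD(2)) auto
  qed
  show ?thesis
    unfolding eventually_prod_filter using half[of a] half[of b] by fastforce
qed

theorem lemma47:
  fixes f :: "real^'s \<Rightarrow> real^'k \<Rightarrow> real^'d"
    and \<Theta> :: "(real^'k) set"
    and g :: "real^'d \<Rightarrow> real^'s"
    and K :: real
    and \<gamma> :: "'m::finite \<Rightarrow> real^'s"
    and P :: "'w measure"
    and X :: "'w \<Rightarrow> real^'d"
    and L :: "'w \<Rightarrow> 'm"
  assumes f_analytic: "real_analytic_on (\<lambda>(c, \<theta>). f c \<theta>) (sphere 0 1 \<times> \<Theta>)"
    and f_sphere: "\<And>c. c \<in> sphere 0 1 \<Longrightarrow> manifold f \<Theta> c \<subseteq> sphere 0 1"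
    and g_analytic: "real_analytic_on g UNIV"
    and g_inverse: "\<And>c \<theta>. c \<in> sphere 0 1 \<Longrightarrow> \<theta> \<in> \<Theta> \<Longrightarrow> g (f c \<theta>) = c"
    and g_norm: "\<And>i. function_norm (\<lambda>x. g x $ i) \<le> ennreal K"
    and latent: "\<And>l. \<gamma> l \<in> sphere 0 1"
    and "prob_space P"
    and "X \<in> borel_measurable P"
    and "L \<in> measurable P (count_space UNIV)"
    and on_manifold: "\<And>l. training_points P X L l \<subseteq> manifold f \<Theta> (\<gamma> l)"
    and all_classes: "\<And>l. measure P {\<omega> \<in> space P. L \<omega> = l} > 0"
    and hidden_width: "CARD('m) \<le> CARD('p::finite)"
  shows "\<forall>\<^sub>F (lam1, lam2) in at_right 0 \<times>\<^sub>F at_right 0.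
     \<forall>(A :: real^'p^'m) (B :: (real^'d) \<times> real \<Rightarrow> real^'p).
       is_constrained_minimizer P X L lam1 lam2 A B \<longrightarrow>
       (\<exists>R :: real^'p^'s. \<forall>l. \<forall>x\<in>training_points P X L l. R *v layer_map B x = \<gamma> l)"
proof -
  define s where "s l = sqrt (measure P {\<omega> \<in> space P. L \<omega> = l})" for l
  have s_pos: "s l > 0" for l
    using all_classes by (simp add: s_def)
  define wt :: "real^'m \<Rightarrow> real^'m" where "wt c = (\<chi> l. s l * c $ l)" for c
  have lin_wt: "linear wt"
    by (intro linearI) (simp_all add: wt_def vec_eq_iff algebra_simps)
  define T where "T = wt ` realizable_values P X L"
  have T: "subspace T"
    unfolding T_def by (intro linear_subspace_image lin_wt subspace_realizable_values)

  have \<gamma>_T: "wt (\<chi> l. \<gamma> l $ i) \<in> T" for i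
  proof -
    obtain a where a: "a \<in> layer_weights" "\<And>x. x \<in> sphere 0 1 \<Longrightarrow> layer_map a x = g x $ i"
      using function_norm_finite_imp_layer_map[OF g_norm[of i]] by blast
    have "layer_map a (X \<omega>) = \<gamma> (L \<omega>) $ i" if "\<omega> \<in> space P" for \<omega>
    proof -
      have X: "X \<omega> \<in> manifold f \<Theta> (\<gamma> (L \<omega>))"
        using on_manifold[of "L \<omega>"] that by (auto simp: training_points_def)
      then have "g (X \<omega>) = \<gamma> (L \<omega>)"
        using g_inverse latent by (auto simp: manifold_def)
      \<comment> \<open>The weights \<open>a\<close> represent the coordinate of \<open>g\<close> on
        the unit sphere, so the training point has to be placed there.\<close>
      moreover have "X \<omega> \<in> sphere 0 1"
        using X f_sphere latent by blast
      ultimately show ?thesis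
        using a(2) by simp
    qed
    then have "(\<chi> l. \<gamma> l $ i) \<in> realizable_values P X L"
      unfolding realizable_values_def using a(1) by auto
    then show ?thesis
      unfolding T_def by (rule imageI)
  qed

  \<comment> \<open>The projection of the scaled label row onto \<open>T\<close> is the best
    achievable vector of class values for output \<open>j\<close>.\<close>
  have "\<exists>q. q \<in> T \<and> (\<forall>t\<in>T. (axis j (s j) - q) \<bullet> t = 0)" for j
  proof -
    obtain q z where "q \<in> span T" "\<And>t. t \<in> span T \<Longrightarrow> orthogonal z t" "axis j (s j) = q + z"
      using orthogonal_subspace_decomp_exists[of T "axis j (s j)"] by metis
    then show ?thesis
      using T by (intro exI[of _ q]) (auto simp: span_eq_iff[THEN iffD2] orthogonal_def)
  qed
  then obtain Q where Q: "\<And>j. Q j \<in> T" "\<And>j t. t \<in> T \<Longrightarrow> (axis j (s j) - Q j) \<bullet> t = 0"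
    by metis
  have "\<forall>j. \<exists>c b. Q j = wt c \<and> b \<in> layer_weights \<and> (\<forall>\<omega>\<in>space P. layer_map b (X \<omega>) = c $ L \<omega>)"
    using Q(1) unfolding T_def realizable_values_def by blast
  then obtain c b where cb: "\<And>j. Q j = wt (c j)" "\<And>j. b j \<in> layer_weights"
      "\<And>j \<omega>. \<omega> \<in> space P \<Longrightarrow> layer_map (b j) (X \<omega>) = c j $ L \<omega>"
    by metis

  \<comment> \<open>A comparison network with optimal loss: hidden coordinate
    \<open>\<iota> j\<close> carries the scalar weights \<open>b j\<close> realising
    \<open>Q j\<close>, and row \<open>j\<close> of \<open>A0\<close> reads that coordinate off. The
    injection exists by \<open>hidden_width\<close>.\<close>
  obtain \<iota> :: "'m \<Rightarrow> 'p" where \<iota>: "inj \<iota>"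
    using hidden_width card_le_inj[of "UNIV :: 'm set" "UNIV :: 'p set"] by auto
  define A0 :: "real^'p^'m" where "A0 = (\<chi> j. axis (\<iota> j) 1)"
  define B0 :: "(real^'d) \<times> real \<Rightarrow> real^'p" where
    "B0 w = (\<Sum>j\<in>UNIV. b j w *\<^sub>R axis (\<iota> j) 1)" for w
  define r0 :: "'m \<Rightarrow> real^'p" where "r0 l = (\<Sum>j\<in>UNIV. c j $ l *\<^sub>R axis (\<iota> j) 1)" for l
  have term_weights: "(\<lambda>w. b j w *\<^sub>R (axis (\<iota> j) 1 :: real^'p)) \<in> layer_weights" for j
    by (rule layer_weights_bounded_linear[OF cb(2) bounded_linear_scaleR_left])
  have B0: "B0 \<in> layer_weights"
    unfolding B0_def by (intro layer_weights_sum term_weights) simp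
  have r0: "layer_map B0 (X \<omega>) = r0 (L \<omega>)" if "\<omega> \<in> space P" for \<omega>
    unfolding B0_def r0_def using that
    by (simp add: layer_map_sum term_weights cb(3)
        layer_map_bounded_linear[OF cb(2) bounded_linear_scaleR_left])
  have Q_eq: "(\<chi> l. s l * (A0 $ j \<bullet> r0 l)) = Q j" for j
  proof -
    have "A0 $ j \<bullet> r0 l = c j $ l" for l
      using \<iota> by (simp add: A0_def r0_def inner_sum_right inner_axis_axis inj_eq
          if_distrib[of "\<lambda>x. _ * x"] cong: if_cong)
    then show ?thesis
      by (simp add: cb(1) wt_def)
  qed
  have feasible: "zero_intra_variance P X L (layer_map B0)"
    using r0 by (auto simp: zero_intra_variance_def training_points_def)

  \<comment> \<open>The smallest class probability; it is positive because there are finitely many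
    classes, each of positive probability.\<close>
  define \<delta> where "\<delta> = Min (range (\<lambda>l. (s l)\<^sup>2))"
  have \<delta>: "\<delta> > 0" "\<And>l. \<delta> \<le> (s l)\<^sup>2"
    using s_pos by (auto simp: \<delta>_def less_imp_neq[OF s_pos, symmetric])

  have main: "\<exists>R :: real^'p^'s. \<forall>l. \<forall>x\<in>training_points P X L l. R *v layer_map B x = \<gamma> l"
    if pos: "0 < lam1" "0 < lam2" and small: "lam1 * (norm A0)\<^sup>2 + lam2 * frobenius_sq B0 < \<delta>"
      and min: "is_constrained_minimizer P X L lam1 lam2 A B"
    for lam1 lam2 and A :: "real^'p^'m" and B :: "(real^'d) \<times> real \<Rightarrow> real^'p"
  proof -
    have B: "B \<in> layer_weights" and ziv: "zero_intra_variance P X L (layer_map B)"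
      and le: "objective P X L lam1 lam2 (A, B) \<le> objective P X L lam1 lam2 (A0, B0)"
      using min B0 feasible by (auto simp: is_constrained_minimizer_def is_arg_min_def not_less)
    \<comment> \<open>Zero intra-manifold variance makes the value independent of the chosen example
      of class \<open>l\<close>.\<close>
    define r where "r l = layer_map B (X (SOME \<omega>. \<omega> \<in> space P \<and> L \<omega> = l))" for l
    have r: "layer_map B (X \<omega>) = r (L \<omega>)" if "\<omega> \<in> space P" for \<omega>
    proof -
      have "\<exists>\<omega>'. \<omega>' \<in> space P \<and> L \<omega>' = L \<omega>"
        using that by blast
      from someI_ex[OF this] show ?thesis
        using ziv that unfolding r_def zero_intra_variance_def training_points_def by blast
    qed
    \<comment> \<open>The scaled row space: class values of all linear functionals \<open>u\<close>
      of the representation. Each is realised by the scalar weights \<open>u \<bullet> B w\<close>,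
      whence \<open>S \<subseteq> T\<close>.\<close>
    define S where "S = range (\<lambda>u. wt (\<chi> l. u \<bullet> r l))"
    have "linear (\<lambda>u. wt (\<chi> l. u \<bullet> r l))"
      by (intro linearI) (simp_all add: wt_def vec_eq_iff algebra_simps)
    then have S: "subspace S"
      unfolding S_def by (intro linear_subspace_image subspace_UNIV)
    have ST: "S \<subseteq> T"
    proof
      fix y assume "y \<in> S"
      then obtain u where y: "y = wt (\<chi> l. u \<bullet> r l)"
        by (auto simp: S_def)
      have "layer_map (\<lambda>w. u \<bullet> B w) (X \<omega>) = u \<bullet> r (L \<omega>)" if "\<omega> \<in> space P" for \<omega>
        using B that by (simp_all add: layer_weights_bounded_linear layer_map_bounded_linear
            bounded_linear_inner_right r)
      moreover have "(\<lambda>w. u \<bullet> B w) \<in> layer_weights"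
        using B by (simp add: layer_weights_bounded_linear bounded_linear_inner_right)
      ultimately have "(\<chi> l. u \<bullet> r l) \<in> realizable_values P X L"
        unfolding realizable_values_def by auto
      then show "y \<in> T"
        unfolding y T_def by (rule imageI)
    qed
    have "S = T"
    proof (rule subspace_eq_if_near_optimal[OF S T ST _ Q \<delta>(2)])
      show "(\<chi> l. s l * (A $ j \<bullet> r l)) \<in> S" for j
        by (auto simp: S_def wt_def)
      \<comment> \<open>Dropping this penalty bounds the loss of \<open>(A, B)\<close> by its
        objective, hence by that of \<open>(A0, B0)\<close>, which is the optimal loss plus less
        than \<delta>.\<close>
      have "0 \<le> lam1 * (norm A)\<^sup>2 + lam2 * frobenius_sq B"
        using pos by (simp add: frobenius_sq_nonneg)
      then show "(\<Sum>j\<in>UNIV. (norm (axis j (s j) - (\<chi> l. s l * (A $ j \<bullet> r l))))\<^sup>2)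
          < (\<Sum>j\<in>UNIV. (norm (axis j (s j) - Q j))\<^sup>2) + \<delta>"
        using le small
          objective_class_values[where r = r and B = B and X = X and s = s and A = A,
            OF \<open>prob_space P\<close> \<open>L \<in> measurable P (count_space UNIV)\<close> r s_def, of lam1 lam2]
          objective_class_values[where r = r0 and B = B0 and X = X and s = s and A = A0,
            OF \<open>prob_space P\<close> \<open>L \<in> measurable P (count_space UNIV)\<close> r0 s_def, of lam1 lam2]
        by (simp add: Q_eq)
    qed
    then have "\<forall>i. \<exists>u. wt (\<chi> l. \<gamma> l $ i) = wt (\<chi> l. u \<bullet> r l)"
      using \<gamma>_T by (auto simp: S_def)
    then obtain u where "\<And>i. wt (\<chi> l. \<gamma> l $ i) = wt (\<chi> l. u i \<bullet> r l)"
      by metis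
    \<comment> \<open>All \<open>s l\<close> are positive, so the scaling \<open>wt\<close> cancels
      entry by entry; the vectors \<open>u i\<close> become the rows of \<open>R\<close>.\<close>
    then have u: "u i \<bullet> r l = \<gamma> l $ i" for i l
      using s_pos[of l] by (simp add: wt_def vec_eq_iff) (metis less_irrefl)
    have "(\<chi> i. u i) *v r l = \<gamma> l" for l
      by (simp add: vec_eq_iff matrix_vector_mul_component u)
    then show ?thesis
      using r by (intro exI[of _ "\<chi> i. u i"]) (auto simp: training_points_def)
  qed
  \<comment> \<open>\<open>A0\<close> and \<open>B0\<close> were fixed before the regularization
    parameters, so their norms are constants here and one neighbourhood of 0 serves all
    minimizers.\<close>
  show ?thesis
    using eventually_regularization_less[OF zero_le_power2 frobenius_sq_nonneg \<delta>(1),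
        of "norm A0" B0]
    by (rule eventually_mono) (use main in blast)
qed

end
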